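(* Let $\Omega > 0$, $\lambda > 0$, $0 \leq h < \lambda$, $\alpha \geq 0$, $\tau_0 \in \mathbb{R}$ and $\mathrm{T} > 0$ with $\mathrm{T} < \frac{\pi}{\Omega}$. Then any $g \in \mathsf{PW}_\Omega \cap \mathscr{C}^{1,1}_{\lambda-h,\tau_0}$ with $\|g''\|_\infty \leq \frac{2h}{\alpha^2}$ is uniquely determined by its modulo hysteresis samples $\{\mathscr{M}_\lambda^{h,\alpha} g(k\mathrm{T}) \mid k \in \mathbb{Z}\}$. That is, if $g_1, g_2 \in \mathsf{PW}_\Omega \cap \mathscr{C}^{1,1}_{\lambda-h,\tau_0}$ satisfy $\|g_1''\|_\infty \leq \frac{2h}{\alpha^2}$, $\|g_2''\|_\infty \leq \frac{2h}{\alpha^2}$ and $\mathscr{M}_\lambda^{h,\alpha} g_1(k\mathrm{T}) = \mathscr{M}_\lambda^{h,\alpha} g_2(k\mathrm{T})$ for all $k \in \mathbb{Z}$, then $g_1 = g_2$.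
   Context: $\mathsf{PW}_\Omega$ denotes the Paley-Wiener space of square-integrable bandlimited functions on $\mathbb{R}$ with bandwidth $\Omega$ (Fourier transform, in angular frequency, supported in $[-\Omega,\Omega]$), identified with their continuous representatives. Signals are real-valued. $\mathscr{C}^{0,1}(\mathbb{R})$ is the space of Lipschitz continuous functions $\mathbb{R} \to \mathbb{R}$ (differentiable almost everywhere with essentially bounded derivative). For $c > 0$ and $\tau_0 \in \mathbb{R}$, $\mathscr{C}^{0,1}_{c,\tau_0} = \{g \in \mathscr{C}^{0,1}(\mathbb{R}) \mid |g(t)| < c \text{ for all } |t| \geq |\tau_0|\}$ and $\mathscr{C}^{1,1}_{c,\tau_0} = \{g \in \mathscr{C}^{0,1}_{c,\tau_0} \mid g' \in \mathscr{C}^{0,1}(\mathbb{R})\}$. $\|g''\|_\infty$ is the essential supremum of $|g''|$. The bound $\frac{2h}{\alpha^2}$ is read as $+\infty$ (no restriction) if $\alpha = 0$ and $h > 0$; the case $\alpha = h = 0$, in which the bound has no meaning, is not considered. Folding transition: $\varepsilon_0 = \mathbb{1}_{[0,\infty)}$ and, for $\alpha > 0$, $\varepsilon_\alpha(t) = \frac{t}{\alpha}\mathbb{1}_{[0,\alpha)}(t) + \mathbb{1}_{[\alpha,\infty)}(t)$. Modified modulo hysteresis operator: for $\lambda > 0$, $h \geq 0$, $\alpha \geq 0$, a starting point $\tau_0 \in \mathbb{R}$ and $g : \mathbb{R} \to \mathbb{R}$, set $\kappa_0 = \tau_0$, $\zeta_0 = g$ and recursively for $n \in \mathbb{N}_0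 = \{0,1,2,\ldots\}$ $$\kappa_{n+1} = \inf\{t > \kappa_n \mid |\zeta_n(t)| \geq \lambda\}, \qquad \zeta_{n+1} = \zeta_n - (2\lambda - h)\,\mathrm{sgn}(\zeta_n(\kappa_{n+1}))\,\varepsilon_\alpha(\cdot - \kappa_{n+1}),$$ with $\inf \emptyset = \infty$; if $\kappa_{n+1} = \infty$, then $\zeta_{n+1} = \zeta_n$ and all later $\kappa_m$ are $\infty$. Then $\mathscr{M}_\lambda^{h,\alpha} g(t) = \lim_{n\to\infty} \zeta_n(t)$ for $t \in \mathbb{R}$. The starting point $\tau_0$ used in the operator is the same $\tau_0$ as in the function space. *)

theory Defs
  imports "HOL-Analysis.Analysis" "HOL-Probability.Essential_Supremum"
begin

text \<open>
  The Fourier transform of a square-integrable \<open>g\<close>, in angular frequency, is the limit in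
  \<open>L\<^sup>2\<close> of the truncated transforms as \<open>R\<close> tends to infinity; it is determined almost
  everywhere, hence a relation. The \<open>L\<^sup>2\<close> distance is a nonnegative Lebesgue integral, so that
  it is infinite rather than 0 where the integrand fails to be integrable.
\<close>

definition truncated_fourier :: "(real \<Rightarrow> real) \<Rightarrow> real \<Rightarrow> real \<Rightarrow> complex" where
  "truncated_fourier g R \<omega> = (LINT t:{-R..R}|lborel. complex_of_real (g t) * cis (- (\<omega> * t)))"

definition has_L2_fourier :: "(real \<Rightarrow> real) \<Rightarrow> (real \<Rightarrow> complex) \<Rightarrow> bool" where
  "has_L2_fourier g G \<longleftrightarrow>
     G \<in> borel_measurable lborel \<and>
     integrable lborel (\<lambda>\<omega>. (cmod (G \<omega>))\<^sup>2) \<and>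
     ((\<lambda>R. \<integral>\<^sup>+ \<omega>. ennreal ((cmod (G \<omega> - truncated_fourier g R \<omega>))\<^sup>2) \<partial>lborel) \<longlongrightarrow> 0) at_top"

text \<open>Elements of the Paley-Wiener space are represented by their continuous representatives.\<close>

definition PW :: "real \<Rightarrow> (real \<Rightarrow> real) set" where
  "PW \<Omega> = {g. continuous_on UNIV g \<and> integrable lborel (\<lambda>t. (g t)\<^sup>2) \<and>
      (\<exists>G. has_L2_fourier g G \<and> (AE \<omega> in lborel. \<omega> \<notin> {-\<Omega>..\<Omega>} \<longrightarrow> G \<omega> = 0))}"

definition lipschitz_functions :: "(real \<Rightarrow> real) set" where
  "lipschitz_functions = {g. \<exists>L. L-lipschitz_on UNIV g}"

definition C01 :: "real \<Rightarrow> real \<Rightarrow> (real \<Rightarrow> real) set" where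
  "C01 c \<tau>\<^sub>0 = {g \<in> lipschitz_functions. \<forall>t. \<bar>t\<bar> \<ge> \<bar>\<tau>\<^sub>0\<bar> \<longrightarrow> \<bar>g t\<bar> < c}"

text \<open>
  A Lipschitz function whose almost everywhere defined derivative agrees with a continuous
  function is differentiable everywhere, so differentiability on the whole line is part of
  \<open>g'\<close> being Lipschitz.
\<close>

definition C11 :: "real \<Rightarrow> real \<Rightarrow> (real \<Rightarrow> real) set" where
  "C11 c \<tau>\<^sub>0 = {g \<in> C01 c \<tau>\<^sub>0. g differentiable_on UNIV \<and> deriv g \<in> lipschitz_functions}"

text \<open>
  For \<open>f = deriv (deriv g)\<close> with \<open>deriv g\<close> Lipschitz, the derivative is genuine outside a null set.
\<close>

definition Linf_norm :: "(real \<Rightarrow> real) \<Rightarrow> ereal" where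
  "Linf_norm f = esssup lebesgue (\<lambda>t. ereal \<bar>f t\<bar>)"

text \<open>The quotient \<open>2 h / \<alpha>\<^sup>2\<close>, read as \<open>\<infinity>\<close> for \<open>\<alpha> = 0\<close>; meaningless for \<open>\<alpha> = h = 0\<close>.\<close>

definition second_deriv_bound :: "real \<Rightarrow> real \<Rightarrow> ereal" where
  "second_deriv_bound h \<alpha> = (if \<alpha> = 0 then \<infinity> else ereal (2 * h / \<alpha>\<^sup>2))"

definition folding_transition :: "real \<Rightarrow> real \<Rightarrow> real" where
  "folding_transition \<alpha> t =
     (if \<alpha> = 0 then indicator {0..} t
      else t / \<alpha> * indicator {0..<\<alpha>} t + indicator {\<alpha>..} t)"

text \<open>
  Folding times live in \<open>ereal\<close>, where \<open>Inf {} = \<infinity>\<close>. Once a folding time is \<open>\<infinity>\<close>, the set in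
  the next one is empty, so all later ones are \<open>\<infinity>\<close> as well.
\<close>

function fold_time :: "real \<Rightarrow> real \<Rightarrow> real \<Rightarrow> real \<Rightarrow> (real \<Rightarrow> real) \<Rightarrow> nat \<Rightarrow> ereal"
  and fold_signal :: "real \<Rightarrow> real \<Rightarrow> real \<Rightarrow> real \<Rightarrow> (real \<Rightarrow> real) \<Rightarrow> nat \<Rightarrow> real \<Rightarrow> real"
where
  "fold_time lam h \<alpha> \<tau>\<^sub>0 g 0 = ereal \<tau>\<^sub>0"
| "fold_time lam h \<alpha> \<tau>\<^sub>0 g (Suc n) =
     Inf {ereal t |t. fold_time lam h \<alpha> \<tau>\<^sub>0 g n < ereal t \<and> \<bar>fold_signal lam h \<alpha> \<tau>\<^sub>0 g n t\<bar> \<ge> lam}"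
| "fold_signal lam h \<alpha> \<tau>\<^sub>0 g 0 t = g t"
| "fold_signal lam h \<alpha> \<tau>\<^sub>0 g (Suc n) t =
     (if fold_time lam h \<alpha> \<tau>\<^sub>0 g (Suc n) = \<infinity> then fold_signal lam h \<alpha> \<tau>\<^sub>0 g n t
      else fold_signal lam h \<alpha> \<tau>\<^sub>0 g n t
        - (2 * lam - h)
          * sgn (fold_signal lam h \<alpha> \<tau>\<^sub>0 g n (real_of_ereal (fold_time lam h \<alpha> \<tau>\<^sub>0 g (Suc n))))
          * folding_transition \<alpha> (t - real_of_ereal (fold_time lam h \<alpha> \<tau>\<^sub>0 g (Suc n))))"
  by pat_completeness auto
termination
  by (relation "Wellfounded.measure (\<lambda>x. case x of
        Inl (_, _, _, _, _, n) \<Rightarrow> 2 * n | Inr (_, _, _, _, _, n, _) \<Rightarrow> 2 * n + 1)") auto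

text \<open>The value is meaningful only where the sequence of folded signals converges at \<open>t\<close>.\<close>

definition modulo_hysteresis ::
    "real \<Rightarrow> real \<Rightarrow> real \<Rightarrow> real \<Rightarrow> (real \<Rightarrow> real) \<Rightarrow> real \<Rightarrow> real" where
  "modulo_hysteresis lam h \<alpha> \<tau>\<^sub>0 g t = lim (\<lambda>n. fold_signal lam h \<alpha> \<tau>\<^sub>0 g n t)"

end

theory Submission
  imports Defs "HOL-Probability.Characteristic_Functions"
begin

text \<open>
  The operator leaves a signal unchanged before the starting point \<open>\<tau>\<^sub>0\<close>: no folding has taken place
  there (\<open>modulo_hysteresis_before_start\<close>). So the two signals agree at all sampling points
  \<open>k * T < \<tau>\<^sub>0\<close>, and it suffices that an oversampled function of \<open>PW \<Omega>\<close> is determined by its samples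
  on a left half-line (\<open>PW_eq_of_eq_on_half_line\<close>).

  Fourier inversion (\<open>fourier_inversion\<close>) writes the difference of the signals at \<open>x\<close> as a multiple
  of \<open>\<integral> \<phi> \<omega> * cis (\<omega> * x)\<close> with an integrable \<open>\<phi>\<close> that vanishes outside \<open>{-\<Omega>..\<Omega>}\<close>. Put
  \<open>z \<omega> = cis (- (T * \<omega>))\<close>. After a shift in time, the vanishing of the samples on the half-line means
  that \<open>\<phi>\<close> annihilates \<open>z ^ n\<close> for all natural \<open>n\<close>. Because \<open>T < pi / \<Omega>\<close>, the values of \<open>z\<close> on the
  band lie in a proper closed arc of the unit circle, and on such an arc the nonnegative powers
  already span a dense subspace of the continuous functions: a pole on the negative real axis can be
  pushed from \<open>-2\<close>, where \<open>1 / (z + 2)\<close> is a power series in \<open>z\<close>, to \<open>0\<close> without meeting the arc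
  (\<open>multiplier_inverse_z\<close>), and once \<open>1 / z\<close> is available the Stone-Weierstrass theorem applies
  (\<open>annihilates_continuous\<close>). Hence \<open>\<phi>\<close> annihilates every \<open>cis (\<omega> * x)\<close>, which is a continuous
  function of \<open>z \<omega>\<close> as \<open>z\<close> stays away from the branch cut of the logarithm.
\<close>

section \<open>Approximation by powers on a proper arc of the circle\<close>

text \<open>
  The arc \<open>{w. cmod w = 1 \<and> \<kappa> \<le> Re w}\<close> misses \<open>-1\<close>, so its complement is connected, and
  polynomials in \<open>w\<close> alone are uniformly dense in the continuous functions on it; on the whole
  circle \<open>1 / w\<close> would be out of reach. The density is proved here in dual form: an integrable
  \<open>\<phi>\<close> that annihilates all nonnegative powers of \<open>z\<close> annihilates every continuous function of \<open>z\<close>.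
\<close>

locale proper_arc_map =
  fixes M :: "'a measure" and z :: "'a \<Rightarrow> complex" and \<kappa> :: real
  assumes measurable_z [measurable]: "z \<in> borel_measurable M"
    and norm_z: "\<And>\<omega>. \<omega> \<in> space M \<Longrightarrow> cmod (z \<omega>) = 1"
    and Re_z: "\<And>\<omega>. \<omega> \<in> space M \<Longrightarrow> \<kappa> \<le> Re (z \<omega>)"
    and \<kappa>_gt: "- 1 < \<kappa>"
begin

definition annihilates_powers :: "('a \<Rightarrow> complex) \<Rightarrow> bool" where
  "annihilates_powers \<phi> \<longleftrightarrow> integrable M \<phi> \<and> (\<forall>n::nat. (LINT \<omega>|M. \<phi> \<omega> * z \<omega> ^ n) = 0)"

text \<open>
  Quantifying over all \<open>\<phi>\<close>, instead of fixing one, makes the set of multipliers closed under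
  products, as the geometric series and the Stone-Weierstrass theorem require.
\<close>

definition multiplier :: "('a \<Rightarrow> complex) \<Rightarrow> bool" where
  "multiplier H \<longleftrightarrow> H \<in> borel_measurable M \<and> (\<exists>B. \<forall>\<omega>\<in>space M. cmod (H \<omega>) \<le> B) \<and>
     (\<forall>\<phi>. annihilates_powers \<phi> \<longrightarrow> annihilates_powers (\<lambda>\<omega>. H \<omega> * \<phi> \<omega>))"

lemma integrable_bounded_times:
  fixes \<phi> H :: "'a \<Rightarrow> complex"
  assumes [measurable]: "H \<in> borel_measurable M"
    and B: "\<And>\<omega>. \<omega> \<in> space M \<Longrightarrow> cmod (H \<omega>) \<le> B" and \<phi>: "integrable M \<phi>"
  shows "integrable M (\<lambda>\<omega>. H \<omega> * \<phi> \<omega>)"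
proof (rule Bochner_Integration.integrable_bound)
  show "integrable M (\<lambda>\<omega>. complex_of_real B * \<phi> \<omega>)" using \<phi> by simp
  show "(\<lambda>\<omega>. H \<omega> * \<phi> \<omega>) \<in> borel_measurable M" using \<phi> by measurable
  show "AE \<omega> in M. norm (H \<omega> * \<phi> \<omega>) \<le> norm (complex_of_real B * \<phi> \<omega>)"
  proof (rule AE_I2)
    fix \<omega> assume "\<omega> \<in> space M"
    from B[OF this] have "cmod (H \<omega>) \<le> \<bar>B\<bar>" by linarith
    then show "norm (H \<omega> * \<phi> \<omega>) \<le> norm (complex_of_real B * \<phi> \<omega>)"
      by (simp add: norm_mult mult_right_mono)
  qed
qed

lemma integrable_times_power:
  fixes \<phi> :: "'a \<Rightarrow> complex"
  assumes "integrable M \<phi>"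
  shows "integrable M (\<lambda>\<omega>. \<phi> \<omega> * z \<omega> ^ n)"
  using integrable_bounded_times[of "\<lambda>\<omega>. z \<omega> ^ n" 1 \<phi>] assms
  by (simp add: norm_power norm_z mult.commute)

lemma multiplierD:
  assumes "multiplier H"
  shows "H \<in> borel_measurable M" "\<exists>B. \<forall>\<omega>\<in>space M. cmod (H \<omega>) \<le> B"
    "annihilates_powers \<phi> \<Longrightarrow> annihilates_powers (\<lambda>\<omega>. H \<omega> * \<phi> \<omega>)"
  using assms by (auto simp: multiplier_def)

lemma multiplier_const: "multiplier (\<lambda>_. c)"
  by (auto simp: multiplier_def annihilates_powers_def mult.assoc)

lemma multiplier_add:
  assumes "multiplier H" "multiplier K"
  shows "multiplier (\<lambda>\<omega>. H \<omega> + K \<omega>)"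
proof -
  obtain B C where "\<forall>\<omega>\<in>space M. cmod (H \<omega>) \<le> B" "\<forall>\<omega>\<in>space M. cmod (K \<omega>) \<le> C"
    using assms multiplierD(2) by metis
  then have "\<forall>\<omega>\<in>space M. cmod (H \<omega> + K \<omega>) \<le> B + C"
    by (meson add_mono norm_triangle_le)
  moreover have "annihilates_powers (\<lambda>\<omega>. (H \<omega> + K \<omega>) * \<phi> \<omega>)" if "annihilates_powers \<phi>" for \<phi>
    using multiplierD(3)[OF assms(1) that] multiplierD(3)[OF assms(2) that]
    by (auto simp: annihilates_powers_def distrib_right integrable_times_power)
  ultimately show ?thesis
    using assms by (auto simp: multiplier_def)
qed

lemma multiplier_mult:
  assumes "multiplier H" "multiplier K"
  shows "multiplier (\<lambda>\<omega>. H \<omega> * K \<omega>)"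
proof -
  obtain B C where "\<forall>\<omega>\<in>space M. cmod (H \<omega>) \<le> B" "\<forall>\<omega>\<in>space M. cmod (K \<omega>) \<le> C"
    using assms multiplierD(2) by metis
  then have "\<forall>\<omega>\<in>space M. cmod (H \<omega> * K \<omega>) \<le> B * C"
    by (meson norm_mult_ineq mult_mono norm_ge_zero order_trans)
  then show ?thesis
    using assms multiplierD(3)[OF assms(1) multiplierD(3)[OF assms(2)]]
    by (auto simp: multiplier_def mult.assoc)
qed

lemma multiplier_z: "multiplier z"
proof -
  have "annihilates_powers (\<lambda>\<omega>. z \<omega> * \<phi> \<omega>)" if "annihilates_powers \<phi>" for \<phi>
  proof -
    have "(LINT \<omega>|M. z \<omega> * \<phi> \<omega> * z \<omega> ^ n) = (LINT \<omega>|M. \<phi> \<omega> * z \<omega> ^ Suc n)" for n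
      by (intro Bochner_Integration.integral_cong) auto
    then show ?thesis
      using that integrable_times_power[of \<phi> 1]
      by (simp add: annihilates_powers_def mult.commute del: power_Suc)
  qed
  then show ?thesis
    by (auto simp: multiplier_def norm_z)
qed

lemma multiplier_power: "multiplier H \<Longrightarrow> multiplier (\<lambda>\<omega>. H \<omega> ^ n)"
  by (induction n) (auto intro: multiplier_const multiplier_mult)

lemma multiplier_sum:
  assumes "\<And>i. i \<in> I \<Longrightarrow> multiplier (H i)"
  shows "multiplier (\<lambda>\<omega>. \<Sum>i\<in>I. H i \<omega>)"
  using assms
  by (induction I rule: infinite_finite_induct) (auto intro: multiplier_const multiplier_add)

lemma multiplier_uniform_limit:
  assumes [measurable]: "H \<in> borel_measurable M"
    and approx: "\<And>e. e > 0 \<Longrightarrow> \<exists>K. multiplier K \<and> (\<forall>\<omega>\<in>space M. cmod (H \<omega> - K \<omega>) \<le> e)"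
  shows "multiplier H"
proof -
  obtain K1 where K1: "multiplier K1" "\<forall>\<omega>\<in>space M. cmod (H \<omega> - K1 \<omega>) \<le> 1"
    using approx[of 1] by auto
  obtain C where "\<forall>\<omega>\<in>space M. cmod (K1 \<omega>) \<le> C" using multiplierD(2)[OF K1(1)] by auto
  with K1(2) have B: "cmod (H \<omega>) \<le> 1 + C" if "\<omega> \<in> space M" for \<omega>
    using that norm_triangle_ineq[of "H \<omega> - K1 \<omega>" "K1 \<omega>"] by fastforce
  have "annihilates_powers (\<lambda>\<omega>. H \<omega> * \<phi> \<omega>)" if \<phi>: "annihilates_powers \<phi>" for \<phi>
  proof -
    have int: "integrable M \<phi>" using \<phi> by (simp add: annihilates_powers_def)
    have intH: "integrable M (\<lambda>\<omega>. H \<omega> * \<phi> \<omega>)"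
      by (rule integrable_bounded_times[OF _ B int]) auto
    have "(LINT \<omega>|M. H \<omega> * \<phi> \<omega> * z \<omega> ^ n) = 0" for n
    proof -
      have le: "cmod (LINT \<omega>|M. H \<omega> * \<phi> \<omega> * z \<omega> ^ n) \<le> e * (LINT \<omega>|M. cmod (\<phi> \<omega>))"
        if e: "e > 0" for e
      proof -
        obtain K where K: "multiplier K" "\<forall>\<omega>\<in>space M. cmod (H \<omega> - K \<omega>) \<le> e"
          using approx[OF e] by auto
        have K0: "annihilates_powers (\<lambda>\<omega>. K \<omega> * \<phi> \<omega>)" by (rule multiplierD(3)[OF K(1) \<phi>])
        have "(LINT \<omega>|M. H \<omega> * \<phi> \<omega> * z \<omega> ^ n)
            = (LINT \<omega>|M. H \<omega> * \<phi> \<omega> * z \<omega> ^ n - K \<omega> * \<phi> \<omega> * z \<omega> ^ n)"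
          using K0 integrable_times_power[OF intH]
          by (subst Bochner_Integration.integral_diff)
             (auto simp: annihilates_powers_def integrable_times_power)
        also have "cmod \<dots> \<le> (LINT \<omega>|M. e * cmod (\<phi> \<omega>))"
        proof (rule order_trans[OF integral_norm_bound Bochner_Integration.integral_mono])
          show "integrable M (\<lambda>\<omega>. cmod (H \<omega> * \<phi> \<omega> * z \<omega> ^ n - K \<omega> * \<phi> \<omega> * z \<omega> ^ n))"
            using K0 intH
            by (auto simp: annihilates_powers_def
                intro!: integrable_norm Bochner_Integration.integrable_diff integrable_times_power)
          show "integrable M (\<lambda>\<omega>. e * cmod (\<phi> \<omega>))" using int by auto
          fix \<omega> assume \<omega>: "\<omega> \<in> space M"
          have "H \<omega> * \<phi> \<omega> * z \<omega> ^ n - K \<omega> * \<phi> \<omega> * z \<omega> ^ n = (H \<omega> - K \<omega>) * \<phi> \<omega> * z \<omega> ^ n"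
            by (simp add: algebra_simps)
          then show "norm (H \<omega> * \<phi> \<omega> * z \<omega> ^ n - K \<omega> * \<phi> \<omega> * z \<omega> ^ n) \<le> e * cmod (\<phi> \<omega>)"
            using K(2) \<omega> by (simp add: norm_mult norm_power norm_z mult_right_mono)
        qed
        finally show ?thesis by simp
      qed
      have "cmod (LINT \<omega>|M. H \<omega> * \<phi> \<omega> * z \<omega> ^ n) \<le> 0 + e" if e: "e > 0" for e
      proof -
        define J where "J = (LINT \<omega>|M. cmod (\<phi> \<omega>))"
        have "J \<ge> 0" by (simp add: J_def)
        then have "e / (J + 1) * J \<le> e" "e / (J + 1) > 0"
          using that by (auto simp: field_simps)
        with le[of "e / (J + 1)"] show ?thesis unfolding J_def by linarith
      qed
      then have "cmod (LINT \<omega>|M. H \<omega> * \<phi> \<omega> * z \<omega> ^ n) \<le> 0"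
        by (rule field_le_epsilon)
      then show ?thesis by simp
    qed
    with intH show ?thesis by (simp add: annihilates_powers_def)
  qed
  with B show ?thesis by (auto simp: multiplier_def)
qed

lemma multiplier_cong:
  assumes "multiplier K" "\<And>\<omega>. \<omega> \<in> space M \<Longrightarrow> K \<omega> = H \<omega>" "H \<in> borel_measurable M"
  shows "multiplier H"
proof (rule multiplier_uniform_limit)
  show "\<exists>K. multiplier K \<and> (\<forall>\<omega>\<in>space M. cmod (H \<omega> - K \<omega>) \<le> e)" if "e > 0" for e
    using assms(1,2) that by (intro exI[of _ K]) auto
qed fact

text \<open>
  The partial sums of the geometric series are multipliers and converge uniformly. Iterated, this
  moves a pole: if \<open>1 / (z + r)\<close> is a multiplier, so is \<open>1 / (z + r')\<close> for all \<open>r'\<close> near \<open>r\<close>.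
\<close>

lemma multiplier_geometric:
  assumes u: "multiplier u" and small: "\<And>\<omega>. \<omega> \<in> space M \<Longrightarrow> cmod (u \<omega>) \<le> 1 / 2"
  shows "multiplier (\<lambda>\<omega>. 1 / (1 - u \<omega>))"
proof (rule multiplier_uniform_limit)
  have [measurable]: "u \<in> borel_measurable M" by (rule multiplierD(1)[OF u])
  show "(\<lambda>\<omega>. 1 / (1 - u \<omega>)) \<in> borel_measurable M" by measurable
  fix e :: real assume "e > 0"
  then obtain n where n: "(1 / 2) ^ n < e / 2"
    using real_arch_pow_inv[of "e / 2" "1 / 2"] by auto
  show "\<exists>K. multiplier K \<and> (\<forall>\<omega>\<in>space M. cmod (1 / (1 - u \<omega>) - K \<omega>) \<le> e)"
  proof (intro exI[of _ "\<lambda>\<omega>. \<Sum>i<n. u \<omega> ^ i"] conjI ballI)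
    show "multiplier (\<lambda>\<omega>. \<Sum>i<n. u \<omega> ^ i)" by (intro multiplier_sum multiplier_power u)
    fix \<omega> assume \<omega>: "\<omega> \<in> space M"
    have d: "cmod (1 - u \<omega>) \<ge> 1 / 2"
      using small[OF \<omega>] norm_triangle_ineq2[of 1 "u \<omega>"] by simp
    then have ne: "u \<omega> \<noteq> 1" by auto
    have "1 / (1 - u \<omega>) - (\<Sum>i<n. u \<omega> ^ i) = u \<omega> ^ n / (1 - u \<omega>)"
      using ne by (simp add: sum_gp_strict diff_divide_distrib)
    also have "cmod \<dots> \<le> (1 / 2) ^ n / (1 / 2)"
      unfolding norm_divide norm_power
      using d small[OF \<omega>] by (intro frac_le power_mono) auto
    finally show "cmod (1 / (1 - u \<omega>) - (\<Sum>i<n. u \<omega> ^ i)) \<le> e" using n by simp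
  qed
qed

text \<open>
  This gives a step length for moving the pole that is the same at every point of the negative
  axis: for \<open>cmod w = 1\<close>, \<open>(cmod (w + r))\<^sup>2 = 1 + 2 * r * Re w + r\<^sup>2\<close>, where \<open>2 * r \<le> 1 + r\<^sup>2\<close> absorbs
  the middle term when \<open>Re w\<close> is negative.
\<close>

lemma arc_separated_from_negative_axis:
  obtains \<delta> where "0 < \<delta>" "\<And>\<omega> r. \<omega> \<in> space M \<Longrightarrow> 0 \<le> r \<Longrightarrow> \<delta> \<le> cmod (z \<omega> + of_real r)"
proof
  define m where "m = min 1 (1 + \<kappa>)"
  show "0 < sqrt m" using \<kappa>_gt by (simp add: m_def)
  fix \<omega> r assume \<omega>: "\<omega> \<in> space M" and r: "(0::real) \<le> r"
  have m: "0 < m" "m \<le> 1" "m \<le> 1 + \<kappa>" using \<kappa>_gt by (auto simp: m_def)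
  have "(cmod (z \<omega>))\<^sup>2 = 1" using norm_z[OF \<omega>] by simp
  then have eq: "(cmod (z \<omega> + of_real r))\<^sup>2 = 1 + 2 * r * Re (z \<omega>) + r\<^sup>2"
    by (simp add: cmod_power2 power2_sum)
  have "2 * r * (m - 1) \<le> 2 * r * Re (z \<omega>)"
    using Re_z[OF \<omega>] m r by (intro mult_left_mono) auto
  moreover have "0 \<le> (1 - m) * (1 - r)\<^sup>2" "0 \<le> m * r\<^sup>2" using m by auto
  ultimately have "m \<le> (cmod (z \<omega> + of_real r))\<^sup>2"
    unfolding eq by (simp add: power2_eq_square algebra_simps)
  then show "sqrt m \<le> cmod (z \<omega> + of_real r)" by (simp add: real_le_lsqrt)
qed

text \<open>
  Pole pushing in the manner of Runge. At \<open>-2\<close> the pole is outside the closed unit disc, and the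
  geometric series in \<open>z / 2\<close> applies. Finitely many steps of length at most \<open>\<delta> / 2\<close> along the
  negative axis, which avoids the arc, then bring it to \<open>0\<close>.
\<close>

lemma multiplier_inverse_z: "multiplier (\<lambda>\<omega>. 1 / z \<omega>)"
proof -
  obtain \<delta> where \<delta>: "0 < \<delta>" "\<And>\<omega> r. \<omega> \<in> space M \<Longrightarrow> 0 \<le> r \<Longrightarrow> \<delta> \<le> cmod (z \<omega> + of_real r)"
    by (rule arc_separated_from_negative_axis) blast
  obtain N :: nat where N: "4 / \<delta> < N" using reals_Archimedean2 by blast
  then have Npos: "0 < N" using \<delta>(1) by (cases N) auto
  define s where "s = 2 / real N"
  have s: "0 < s" "s \<le> \<delta> / 2" "real N * s = 2"
    using N Npos \<delta>(1) by (auto simp: s_def field_simps)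
  have "multiplier (\<lambda>\<omega>. 1 / (z \<omega> + of_real (2 - real j * s)))" if "j \<le> N" for j
    using that
  proof (induction j)
    case 0
    have "multiplier (\<lambda>\<omega>. - (1 / 2) * z \<omega>)" by (intro multiplier_mult multiplier_const multiplier_z)
    then have "multiplier (\<lambda>\<omega>. 1 / (1 - - (1 / 2) * z \<omega>))"
      by (rule multiplier_geometric) (simp add: norm_mult norm_z)
    then have "multiplier (\<lambda>\<omega>. (1 / 2) * (1 / (1 - - (1 / 2) * z \<omega>)))"
      by (intro multiplier_mult multiplier_const)
    then show ?case by (simp add: field_simps)
  next
    case (Suc j)
    define r where "r = 2 - real j * s"
    define u where "u = (\<lambda>\<omega>. 1 / (z \<omega> + of_real r))"
    have "real (Suc j) * s \<le> 2"
      using Suc.prems s by (metis mult_right_mono of_nat_le_iff less_imp_le)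
    then have r': "r - s \<ge> 0" by (simp add: r_def algebra_simps)
    have u: "multiplier u" using Suc by (simp add: u_def r_def)
    have small: "cmod (of_real s * u \<omega>) \<le> 1 / 2" if "\<omega> \<in> space M" for \<omega>
    proof -
      have "\<delta> \<le> cmod (z \<omega> + of_real r)" using \<delta>(2)[OF that] r' s(1) by simp
      then have "s / cmod (z \<omega> + of_real r) \<le> (\<delta> / 2) / \<delta>"
        using s \<delta>(1) by (intro frac_le) auto
      then show ?thesis using s \<delta>(1) by (simp add: u_def norm_mult norm_divide)
    qed
    have shifted: "multiplier (\<lambda>\<omega>. u \<omega> * (1 / (1 - of_real s * u \<omega>)))"
      by (intro multiplier_mult u multiplier_geometric multiplier_const small)
    have eq: "u \<omega> * (1 / (1 - of_real s * u \<omega>)) = 1 / (z \<omega> + of_real (2 - real (Suc j) * s))"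
      if "\<omega> \<in> space M" for \<omega>
    proof -
      have "z \<omega> + of_real r \<noteq> 0" using \<delta>(2)[OF that, of r] \<delta>(1) r' s(1) by auto
      then have "u \<omega> * (1 / (1 - of_real s * u \<omega>)) = 1 / (z \<omega> + of_real r - of_real s)"
        by (simp add: u_def divide_simps)
      also have "z \<omega> + of_real r - of_real s = z \<omega> + of_real (2 - real (Suc j) * s)"
        by (simp add: r_def algebra_simps)
      finally show ?thesis .
    qed
    show ?case by (rule multiplier_cong[OF shifted eq]) measurable
  qed
  from this[of N] show ?thesis using s(3) by simp
qed

text \<open>
  On the unit circle \<open>1 / w = cnj w\<close>, so \<open>w\<close> and \<open>1 / w\<close> together give all real-linear functions.
\<close>

lemma multiplier_real_polynomial_function:
  assumes "real_polynomial_function p"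
  shows "multiplier (\<lambda>\<omega>. of_real (p (z \<omega>)))"
  using assms
proof (induction p rule: real_polynomial_function.induct)
  case (linear f)
  interpret bounded_linear f by fact
  have lin: "f w = Re w * f 1 + Im w * f \<i>" for w
  proof -
    have "w = Re w *\<^sub>R 1 + Im w *\<^sub>R \<i>" by (simp add: complex_eq_iff)
    then show ?thesis by (metis add scaleR real_scaleR_def)
  qed
  \<comment> \<open>With these values \<open>(a + b) * w + (a - b) * cnj w = Re w * f 1 + Im w * f \<i>\<close>.\<close>
  define a b where "a = complex_of_real (f 1) / 2" and "b = complex_of_real (f \<i>) / (2 * \<i>)"
  have "multiplier (\<lambda>\<omega>. (a + b) * z \<omega> + (a - b) * (1 / z \<omega>))"
    by (intro multiplier_add multiplier_mult multiplier_const multiplier_z multiplier_inverse_z)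
  moreover have "(a + b) * z \<omega> + (a - b) * (1 / z \<omega>) = of_real (f (z \<omega>))" if "\<omega> \<in> space M" for \<omega>
  proof -
    have "z \<omega> * cnj (z \<omega>) = 1" using norm_z[OF that] by (simp add: complex_norm_square[symmetric])
    then have inv: "1 / z \<omega> = cnj (z \<omega>)" by (cases "z \<omega> = 0") (auto simp: field_simps)
    show ?thesis
      unfolding inv lin[of "z \<omega>"] by (simp add: a_def b_def complex_eq_iff field_simps)
  qed
  moreover have "(\<lambda>\<omega>. complex_of_real (f (z \<omega>))) \<in> borel_measurable M"
    unfolding lin[of "z _"] by measurable
  ultimately show ?case by (rule multiplier_cong)
next
  case (const c)
  then show ?case by (rule multiplier_const)
next
  case (add f g)
  then show ?case by (simp add: multiplier_add)
next
  case (mult f g)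
  then show ?case by (simp add: multiplier_mult)
qed

lemma annihilates_continuous:
  assumes \<phi>: "annihilates_powers \<phi>"
    and f: "continuous_on {w. cmod w = 1 \<and> \<kappa> \<le> Re w} f"
  shows "(LINT \<omega>|M. f (z \<omega>) * \<phi> \<omega>) = 0"
proof -
  define S where "S = {w. cmod w = 1 \<and> \<kappa> \<le> Re w}"
  have "closed S" unfolding S_def
    by (intro closed_Collect_conj closed_Collect_eq closed_Collect_le continuous_intros)
  moreover have "bounded S" unfolding S_def by (rule boundedI[of _ 1]) auto
  ultimately have S: "compact S" by (simp add: compact_eq_bounded_closed)
  have zS: "z \<omega> \<in> S" if "\<omega> \<in> space M" for \<omega> using that by (simp add: S_def norm_z Re_z)
  have "multiplier (\<lambda>\<omega>. f (z \<omega>))"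
  proof (rule multiplier_uniform_limit)
    have "f \<in> borel_measurable (restrict_space borel S)"
      using f by (intro borel_measurable_continuous_on_restrict) (simp add: S_def)
    moreover have "z \<in> measurable M (restrict_space borel S)"
      by (rule measurable_restrict_space2) (use zS in auto)
    ultimately show "(\<lambda>\<omega>. f (z \<omega>)) \<in> borel_measurable M"
      by (rule measurable_compose[rotated])
    fix e :: real assume "e > 0"
    with Stone_Weierstrass_polynomial_function[OF S f[folded S_def]]
    obtain q where q: "polynomial_function q" "\<forall>w\<in>S. norm (f w - q w) < e" by auto
    have "real_polynomial_function (Re \<circ> q)" "real_polynomial_function (Im \<circ> q)"
      using q(1) by (auto simp: polynomial_function_def bounded_linear_Re bounded_linear_Im)
    then have "multiplier (\<lambda>\<omega>. of_real ((Re \<circ> q) (z \<omega>)) + \<i> * of_real ((Im \<circ> q) (z \<omega>)))"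
      by (intro multiplier_add multiplier_mult multiplier_const multiplier_real_polynomial_function)
    then have "multiplier (\<lambda>\<omega>. q (z \<omega>))" by (simp flip: complex_eq)
    with q(2) zS show "\<exists>K. multiplier K \<and> (\<forall>\<omega>\<in>space M. cmod (f (z \<omega>) - K \<omega>) \<le> e)"
      by (intro exI[of _ "\<lambda>\<omega>. q (z \<omega>)"]) (auto intro: less_imp_le)
  qed
  from multiplierD(3)[OF this \<phi>] show ?thesis
    unfolding annihilates_powers_def by (metis (no_types, lifting) mult.right_neutral power_0 Bochner_Integration.integral_cong)
qed

end

section \<open>Fourier inversion by Gaussian summation\<close>

lemma measurable_cis [measurable]: "cis \<in> borel_measurable borel"
  by (intro borel_measurable_continuous_onI continuous_intros)

text \<open>
  Fubini for \<open>f t * cis (- (\<omega> * t)) * \<phi> \<omega>\<close>, whose modulus is a product of integrable functions. It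
  moves the Fourier transform from the signal to a test function.
\<close>

lemma
  fixes f \<phi> :: "real \<Rightarrow> complex"
  assumes f: "integrable lborel f" and \<phi>: "integrable lborel \<phi>"
  shows integrable_fourier_times:
      "integrable lborel (\<lambda>\<omega>. (LINT t|lborel. f t * cis (- (\<omega> * t))) * \<phi> \<omega>)"
    and fourier_multiplication_formula:
      "(LINT \<omega>|lborel. (LINT t|lborel. f t * cis (- (\<omega> * t))) * \<phi> \<omega>)
       = (LINT t|lborel. f t * (LINT \<omega>|lborel. \<phi> \<omega> * cis (- (\<omega> * t))))"
proof -
  have [measurable]: "f \<in> borel_measurable borel" "\<phi> \<in> borel_measurable borel"
    using f \<phi> by (auto dest: borel_measurable_integrable)
  define k where "k = (\<lambda>\<omega> t. f t * cis (- (\<omega> * t)) * \<phi> \<omega>)"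
  have k: "integrable (lborel \<Otimes>\<^sub>M lborel) (\<lambda>(\<omega>, t). k \<omega> t)"
  proof (rule lborel_pair.Fubini_integrable)
    show "(\<lambda>(\<omega>, t). k \<omega> t) \<in> borel_measurable (lborel \<Otimes>\<^sub>M lborel)"
      unfolding k_def by measurable
    show "integrable lborel (\<lambda>\<omega>. LINT t|lborel. norm (case (\<omega>, t) of (\<omega>, t) \<Rightarrow> k \<omega> t))"
      using \<phi> by (simp add: k_def norm_mult)
    have "integrable lborel (\<lambda>t. k \<omega> t)" for \<omega>
    proof (rule Bochner_Integration.integrable_bound)
      show "integrable lborel (\<lambda>t. f t * \<phi> \<omega>)" using f by simp
    qed (auto simp: k_def norm_mult)
    then show "AE \<omega> in lborel. integrable lborel (\<lambda>t. case (\<omega>, t) of (\<omega>, t) \<Rightarrow> k \<omega> t)"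
      by simp
  qed
  have inner: "(LINT t|lborel. k \<omega> t) = (LINT t|lborel. f t * cis (- (\<omega> * t))) * \<phi> \<omega>" for \<omega>
    by (simp add: k_def)
  have inner': "(LINT \<omega>|lborel. k \<omega> t) = f t * (LINT \<omega>|lborel. \<phi> \<omega> * cis (- (\<omega> * t)))" for t
    unfolding k_def by (subst integral_mult_right_zero[symmetric]) (simp add: mult_ac)
  show "integrable lborel (\<lambda>\<omega>. (LINT t|lborel. f t * cis (- (\<omega> * t))) * \<phi> \<omega>)"
    using lborel_pair.integrable_fst'[OF k] by (simp add: inner)
  show "(LINT \<omega>|lborel. (LINT t|lborel. f t * cis (- (\<omega> * t))) * \<phi> \<omega>)
       = (LINT t|lborel. f t * (LINT \<omega>|lborel. \<phi> \<omega> * cis (- (\<omega> * t))))"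
    using lborel_pair.Fubini_integral[OF k] by (simp add: inner inner')
qed

lemma
  assumes "\<epsilon> > 0"
  shows integrable_gaussian: "integrable lborel (\<lambda>\<omega>. std_normal_density (\<epsilon> * \<omega>))"
    and fourier_gaussian:
    "(LINT \<omega>|lborel. complex_of_real (std_normal_density (\<epsilon> * \<omega>)) * cis (\<omega> * s))
      = complex_of_real (sqrt (2 * pi) / \<epsilon> * std_normal_density (s / \<epsilon>))"
proof -
  show "integrable lborel (\<lambda>\<omega>. std_normal_density (\<epsilon> * \<omega>))"
    using lborel_integrable_real_affine[of std_normal_density \<epsilon> 0] assms by simp
  define u where "u = s / \<epsilon>"
  have "complex_of_real (exp (- u\<^sup>2 / 2)) = char std_normal_distribution u"
    by (simp add: char_std_normal_distribution)
  also have "\<dots> = (LINT x|lborel. std_normal_density x *\<^sub>R cis (u * x))"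
    unfolding char_def cis_conv_exp[symmetric]
    by (subst integral_density) auto
  also have "\<dots> = \<epsilon> *\<^sub>R (LINT \<omega>|lborel. std_normal_density (\<epsilon> * \<omega>) *\<^sub>R cis (u * (\<epsilon> * \<omega>)))"
    using assms by (subst lborel_integral_real_affine[where c = \<epsilon> and t = 0]) auto
  also have "(\<lambda>\<omega>. std_normal_density (\<epsilon> * \<omega>) *\<^sub>R cis (u * (\<epsilon> * \<omega>)))
      = (\<lambda>\<omega>. complex_of_real (std_normal_density (\<epsilon> * \<omega>)) * cis (\<omega> * s))"
    using assms by (auto simp: u_def scaleR_conv_of_real mult_ac)
  finally have "complex_of_real (exp (- u\<^sup>2 / 2)) / \<epsilon>
      = (LINT \<omega>|lborel. complex_of_real (std_normal_density (\<epsilon> * \<omega>)) * cis (\<omega> * s))"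
    using assms by (simp add: scaleR_conv_of_real)
  then show "(LINT \<omega>|lborel. complex_of_real (std_normal_density (\<epsilon> * \<omega>)) * cis (\<omega> * s))
      = complex_of_real (sqrt (2 * pi) / \<epsilon> * std_normal_density (s / \<epsilon>))"
    by (simp add: std_normal_density_def u_def)
qed

text \<open>
  Cauchy-Schwarz. It is carried out for nonnegative integrals, where an infinite \<open>L\<^sup>2\<close> distance for
  small \<open>n\<close> does no harm.
\<close>

lemma integral_tendsto_of_L2_tendsto:
  fixes F :: "nat \<Rightarrow> 'a \<Rightarrow> complex" and G \<phi> :: "'a \<Rightarrow> complex"
  assumes [measurable]: "\<And>n. F n \<in> borel_measurable M" "G \<in> borel_measurable M" "\<phi> \<in> borel_measurable M"
    and lim: "(\<lambda>n. \<integral>\<^sup>+ x. ennreal ((cmod (G x - F n x))\<^sup>2) \<partial>M) \<longlonglongrightarrow> 0"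
    and fin: "integrable M (\<lambda>x. (cmod (\<phi> x))\<^sup>2)"
    and F: "\<And>n. integrable M (\<lambda>x. F n x * \<phi> x)" and G: "integrable M (\<lambda>x. G x * \<phi> x)"
  shows "(\<lambda>n. LINT x|M. F n x * \<phi> x) \<longlonglongrightarrow> (LINT x|M. G x * \<phi> x)"
proof -
  define C where "C = (\<integral>\<^sup>+ x. ennreal ((cmod (\<phi> x))\<^sup>2) \<partial>M)"
  have C: "C \<noteq> top" using fin by (simp add: C_def integrable_iff_bounded less_top)
  define D where "D n = (LINT x|M. G x * \<phi> x) - (LINT x|M. F n x * \<phi> x)" for n
  have le: "ennreal ((cmod (D n))\<^sup>2) \<le> (\<integral>\<^sup>+ x. ennreal ((cmod (G x - F n x))\<^sup>2) \<partial>M) * C" for n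
  proof -
    have "D n = (LINT x|M. (G x - F n x) * \<phi> x)"
      unfolding D_def left_diff_distrib using F G by simp
    also have "ennreal (cmod \<dots>) \<le> (\<integral>\<^sup>+ x. ennreal (cmod ((G x - F n x) * \<phi> x)) \<partial>M)"
      using F G by (intro integral_norm_bound_ennreal) (simp add: left_diff_distrib)
    also have "\<dots> = (\<integral>\<^sup>+ x. ennreal (cmod (G x - F n x)) * ennreal (cmod (\<phi> x)) \<partial>M)"
      by (simp add: norm_mult ennreal_mult)
    finally have "(ennreal (cmod (D n)))\<^sup>2
        \<le> (\<integral>\<^sup>+ x. ennreal (cmod (G x - F n x)) * ennreal (cmod (\<phi> x)) \<partial>M)\<^sup>2"
      by (intro power_mono) auto
    also have "\<dots> \<le> (\<integral>\<^sup>+ x. (ennreal (cmod (G x - F n x)))\<^sup>2 \<partial>M) * (\<integral>\<^sup>+ x. (ennreal (cmod (\<phi> x)))\<^sup>2 \<partial>M)"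
      by (rule Cauchy_Schwarz_nn_integral) measurable
    finally show ?thesis by (simp add: C_def ennreal_power)
  qed
  have "(\<lambda>n. (\<integral>\<^sup>+ x. ennreal ((cmod (G x - F n x))\<^sup>2) \<partial>M) * C) \<longlonglongrightarrow> 0 * C"
    using C by (intro tendsto_mult_ennreal[OF lim tendsto_const]) simp
  then have upper: "(\<lambda>n. (\<integral>\<^sup>+ x. ennreal ((cmod (G x - F n x))\<^sup>2) \<partial>M) * C) \<longlonglongrightarrow> ennreal 0"
    by simp
  have "(\<lambda>n. ennreal ((cmod (D n))\<^sup>2)) \<longlonglongrightarrow> ennreal 0"
    by (rule tendsto_sandwich[OF _ always_eventually tendsto_const upper]) (use le in auto)
  then have "(\<lambda>n. (cmod (D n))\<^sup>2) \<longlonglongrightarrow> 0"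
    by (rule tendsto_ennrealD) auto
  then have "(\<lambda>n. sqrt ((cmod (D n))\<^sup>2)) \<longlonglongrightarrow> sqrt 0" by (intro tendsto_intros)
  then have "D \<longlonglongrightarrow> 0" by (simp add: tendsto_norm_zero_iff)
  then have "(\<lambda>n. (LINT x|M. G x * \<phi> x) - D n) \<longlonglongrightarrow> (LINT x|M. G x * \<phi> x) - 0"
    by (intro tendsto_intros)
  then show ?thesis by (simp add: D_def)
qed

text \<open>
  Testing the transform against the Gaussian \<open>\<phi> \<epsilon>\<close> and shifting the transform onto \<open>\<phi> \<epsilon>\<close> turns the
  left-hand side into an average of \<open>g\<close> around \<open>x\<close> against a Gaussian of width \<open>\<epsilon>\<close>. As \<open>\<epsilon>\<close> tends
  to \<open>0\<close>, dominated convergence applies on both sides: on the frequency side by integrability of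
  \<open>G\<close>, on the time side by boundedness and continuity of \<open>g\<close>. Continuity makes the result hold at
  every \<open>x\<close>, as sampling requires.
\<close>

lemma fourier_inversion:
  fixes g :: "real \<Rightarrow> real"
  assumes cont: "continuous_on UNIV g" and B: "\<And>t. \<bar>g t\<bar> \<le> B"
    and G: "has_L2_fourier g G" and intG: "integrable lborel G"
  shows "(LINT \<omega>|lborel. G \<omega> * cis (\<omega> * x)) = 2 * pi * g x"
proof -
  have [measurable]: "g \<in> borel_measurable borel"
    using cont by (rule borel_measurable_continuous_onI)
  have [measurable]: "G \<in> borel_measurable borel"
    using G by (simp add: has_L2_fourier_def)
  define h where "h n t = indicator {- real n..real n} t *\<^sub>R complex_of_real (g t)" for n t
  have h_meas [measurable]: "h n \<in> borel_measurable borel" for n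
    unfolding h_def by measurable
  have h_int: "integrable lborel (h n)" for n
  proof (rule Bochner_Integration.integrable_bound)
    show "integrable lborel (\<lambda>t. B * indicator {- real n..real n} t :: real)" by simp
    show "AE t in lborel. norm (h n t) \<le> norm (B * indicator {- real n..real n} t :: real)"
      using B order_trans[OF B abs_ge_self] by (auto simp: h_def indicator_def)
  qed auto
  have trunc: "truncated_fourier g (real n) \<omega> = (LINT t|lborel. h n t * cis (- (\<omega> * t)))" for n \<omega>
    unfolding truncated_fourier_def set_lebesgue_integral_def h_def by simp
  define \<phi> where "\<phi> \<epsilon> \<omega> = complex_of_real (std_normal_density (\<epsilon> * \<omega>)) * cis (\<omega> * x)" for \<epsilon> \<omega> :: real
  have [measurable]: "\<phi> \<epsilon> \<in> borel_measurable borel" for \<epsilon> unfolding \<phi>_def by measurable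
  have \<phi>_norm: "cmod (\<phi> \<epsilon> \<omega>) = std_normal_density (\<epsilon> * \<omega>)" for \<epsilon> \<omega>
    by (simp add: \<phi>_def norm_mult)
  define c :: real where "c = 1 / sqrt (2 * pi)"
  have c: "c \<ge> 0" by (simp add: c_def)
  have \<phi>_le: "cmod (\<phi> \<epsilon> \<omega>) \<le> c" for \<epsilon> \<omega>
    unfolding \<phi>_norm by (simp add: c_def std_normal_density_def divide_right_mono)
  have G\<phi>: "integrable lborel (\<lambda>\<omega>. G \<omega> * \<phi> \<epsilon> \<omega>)" for \<epsilon>
  proof (rule Bochner_Integration.integrable_bound)
    show "integrable lborel (\<lambda>\<omega>. cmod (G \<omega>) * c)"
      using intG by (intro integrable_mult_left) auto
    show "AE \<omega> in lborel. norm (G \<omega> * \<phi> \<epsilon> \<omega>) \<le> norm (cmod (G \<omega>) * c)"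
      using c by (intro AE_I2) (simp add: norm_mult abs_mult mult_left_mono \<phi>_le)
  qed auto
  have smoothed: "(LINT \<omega>|lborel. G \<omega> * \<phi> \<epsilon> \<omega>)
      = sqrt (2 * pi) * (LINT s|lborel. std_normal_density s * g (x + \<epsilon> * s))"
    if \<epsilon>: "\<epsilon> > 0" for \<epsilon>
  proof -
    \<comment> \<open>The Fourier transform of \<open>\<phi> \<epsilon>\<close>.\<close>
    define K where "K t = sqrt (2 * pi) / \<epsilon> * std_normal_density ((x - t) / \<epsilon>)" for t
    have K_meas [measurable]: "K \<in> borel_measurable borel" unfolding K_def by measurable
    have K_int: "integrable lborel K"
      using lborel_integrable_real_affine[of std_normal_density "- 1 / \<epsilon>" "x / \<epsilon>"] \<epsilon>
      unfolding K_def by (intro integrable_mult_right) (simp add: diff_divide_distrib)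
    have K_nonneg: "K t \<ge> 0" for t using \<epsilon> by (simp add: K_def)
    have \<phi>_int: "integrable lborel (\<phi> \<epsilon>)"
      by (rule Bochner_Integration.integrable_bound[OF integrable_gaussian[OF \<epsilon>]]) (auto simp: \<phi>_norm)
    have \<phi>_sq: "integrable lborel (\<lambda>\<omega>. (cmod (\<phi> \<epsilon> \<omega>))\<^sup>2)"
    proof (rule Bochner_Integration.integrable_bound)
      show "integrable lborel (\<lambda>\<omega>. c * cmod (\<phi> \<epsilon> \<omega>))" using \<phi>_int by simp
      show "AE \<omega> in lborel. norm ((cmod (\<phi> \<epsilon> \<omega>))\<^sup>2) \<le> norm (c * cmod (\<phi> \<epsilon> \<omega>))"
        using c by (intro AE_I2) (simp add: power2_eq_square abs_mult mult_right_mono \<phi>_le)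
    qed auto
    have hat: "(LINT \<omega>|lborel. \<phi> \<epsilon> \<omega> * cis (- (\<omega> * t))) = complex_of_real (K t)" for t
    proof -
      have "\<phi> \<epsilon> \<omega> * cis (- (\<omega> * t)) = complex_of_real (std_normal_density (\<epsilon> * \<omega>)) * cis (\<omega> * (x - t))" for \<omega>
        by (simp add: \<phi>_def cis_mult mult.assoc right_diff_distrib)
      then show ?thesis by (simp only: fourier_gaussian[OF \<epsilon>] K_def)
    qed
    have "(\<lambda>n. LINT \<omega>|lborel. truncated_fourier g (real n) \<omega> * \<phi> \<epsilon> \<omega>) \<longlonglongrightarrow> (LINT \<omega>|lborel. G \<omega> * \<phi> \<epsilon> \<omega>)"
    proof (rule integral_tendsto_of_L2_tendsto[OF _ _ _ _ \<phi>_sq _ G\<phi>])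
      show "(\<lambda>n. \<integral>\<^sup>+ \<omega>. ennreal ((cmod (G \<omega> - truncated_fourier g (real n) \<omega>))\<^sup>2) \<partial>lborel) \<longlonglongrightarrow> 0"
        using G filterlim_compose[OF _ filterlim_real_sequentially] unfolding has_L2_fourier_def by fast
      show "(\<lambda>\<omega>. truncated_fourier g (real n) \<omega>) \<in> borel_measurable lborel" for n
        unfolding trunc by measurable
      show "integrable lborel (\<lambda>\<omega>. truncated_fourier g (real n) \<omega> * \<phi> \<epsilon> \<omega>)" for n
        unfolding trunc by (rule integrable_fourier_times[OF h_int \<phi>_int])
    qed auto
    moreover have "(LINT \<omega>|lborel. truncated_fourier g (real n) \<omega> * \<phi> \<epsilon> \<omega>)
        = (LINT t|lborel. h n t * complex_of_real (K t))" for n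
      unfolding trunc fourier_multiplication_formula[OF h_int \<phi>_int] hat ..
    moreover have "(\<lambda>n. LINT t|lborel. h n t * complex_of_real (K t))
        \<longlonglongrightarrow> (LINT t|lborel. complex_of_real (g t * K t))"
    proof (rule integral_dominated_convergence[where w = "\<lambda>t. B * K t"])
      show "integrable lborel (\<lambda>t. B * K t)" using K_int by simp
      show "AE t in lborel. (\<lambda>n. h n t * complex_of_real (K t)) \<longlonglongrightarrow> complex_of_real (g t * K t)"
      proof (rule AE_I2)
        fix t :: real
        obtain N :: nat where "\<bar>t\<bar> \<le> real N" using real_arch_simple by blast
        then have "\<forall>\<^sub>F n in sequentially. complex_of_real (g t * K t) = h n t * complex_of_real (K t)"
          by (intro eventually_sequentiallyI[of N]) (auto simp: h_def indicator_def)
        then show "(\<lambda>n. h n t * complex_of_real (K t)) \<longlonglongrightarrow> complex_of_real (g t * K t)"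
          by (rule Lim_transform_eventually[OF tendsto_const])
      qed
      show "AE t in lborel. norm (h n t * complex_of_real (K t)) \<le> B * K t" for n
        using B order_trans[OF abs_ge_zero B] K_nonneg
        by (auto simp: h_def norm_mult indicator_def intro!: mult_right_mono)
    qed auto
    ultimately have "(LINT \<omega>|lborel. G \<omega> * \<phi> \<epsilon> \<omega>) = (LINT t|lborel. complex_of_real (g t * K t))"
      by (simp add: LIMSEQ_unique)
    also have "\<dots> = complex_of_real (LINT t|lborel. g t * K t)" by (rule integral_complex_of_real)
    also have "(LINT t|lborel. g t * K t) = \<epsilon> * (LINT s|lborel. g (x + \<epsilon> * s) * K (x + \<epsilon> * s))"
      using \<epsilon> by (subst lborel_integral_real_affine[where c = \<epsilon> and t = x]) auto
    also have "(\<lambda>s. g (x + \<epsilon> * s) * K (x + \<epsilon> * s))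
        = (\<lambda>s. sqrt (2 * pi) / \<epsilon> * (std_normal_density s * g (x + \<epsilon> * s)))"
      using \<epsilon> by (auto simp: K_def std_normal_density_def)
    finally show ?thesis using \<epsilon> by simp
  qed
  \<comment> \<open>Since \<open>\<phi> 0 \<omega> = c * cis (\<omega> * x)\<close>, the left-hand sides tend to \<open>c\<close> times the inversion integral.\<close>
  define \<epsilon> where "\<epsilon> n = inverse (real (Suc n))" for n
  have \<epsilon>_pos: "\<epsilon> n > 0" for n by (simp add: \<epsilon>_def)
  have \<epsilon>_lim: "\<epsilon> \<longlonglongrightarrow> 0" unfolding \<epsilon>_def by (rule LIMSEQ_inverse_real_of_nat)
  have "(\<lambda>n. LINT \<omega>|lborel. G \<omega> * \<phi> (\<epsilon> n) \<omega>) \<longlonglongrightarrow> (LINT \<omega>|lborel. G \<omega> * \<phi> 0 \<omega>)"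
  proof (rule integral_dominated_convergence[where w = "\<lambda>\<omega>. cmod (G \<omega>) * c"])
    show "integrable lborel (\<lambda>\<omega>. cmod (G \<omega>) * c)"
      using intG by (intro integrable_mult_left) auto
    show "AE \<omega> in lborel. (\<lambda>n. G \<omega> * \<phi> (\<epsilon> n) \<omega>) \<longlonglongrightarrow> G \<omega> * \<phi> 0 \<omega>"
      unfolding \<phi>_def std_normal_density_def by (intro AE_I2 tendsto_intros \<epsilon>_lim) auto
    show "AE \<omega> in lborel. norm (G \<omega> * \<phi> (\<epsilon> n) \<omega>) \<le> cmod (G \<omega>) * c" for n
      unfolding norm_mult using \<phi>_le by (intro AE_I2 mult_left_mono) auto
  qed auto
  moreover have "(\<lambda>n. LINT s|lborel. std_normal_density s * g (x + \<epsilon> n * s))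
      \<longlonglongrightarrow> (LINT s|lborel. std_normal_density s * g x)"
  proof (rule integral_dominated_convergence[where w = "\<lambda>s. std_normal_density s * B"])
    have "isCont g x" using cont by (simp add: continuous_on_eq_continuous_at)
    moreover have "(\<lambda>n. x + \<epsilon> n * s) \<longlonglongrightarrow> x" for s
      using tendsto_add[OF tendsto_const[of x] tendsto_mult[OF \<epsilon>_lim tendsto_const[of s]]] by simp
    ultimately have "(\<lambda>n. g (x + \<epsilon> n * s)) \<longlonglongrightarrow> g x" for s
      by (rule isCont_tendsto_compose)
    then show "AE s in lborel. (\<lambda>n. std_normal_density s * g (x + \<epsilon> n * s)) \<longlonglongrightarrow> std_normal_density s * g x"
      by (intro AE_I2 tendsto_mult_left)
    show "AE s in lborel. norm (std_normal_density s * g (x + \<epsilon> n * s)) \<le> std_normal_density s * B" for n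
      using B by (auto simp: abs_mult intro!: mult_left_mono)
  qed auto
  then have "(\<lambda>n. LINT s|lborel. std_normal_density s * g (x + \<epsilon> n * s)) \<longlonglongrightarrow> g x"
    by simp
  then have "(\<lambda>n. LINT \<omega>|lborel. G \<omega> * \<phi> (\<epsilon> n) \<omega>) \<longlonglongrightarrow> complex_of_real (sqrt (2 * pi) * g x)"
    unfolding smoothed[OF \<epsilon>_pos] by (rule tendsto_of_real[OF tendsto_mult[OF tendsto_const]])
  ultimately have "(LINT \<omega>|lborel. G \<omega> * \<phi> 0 \<omega>) = complex_of_real (sqrt (2 * pi) * g x)"
    by (rule LIMSEQ_unique)
  moreover have "(LINT \<omega>|lborel. G \<omega> * \<phi> 0 \<omega>) = (LINT \<omega>|lborel. G \<omega> * cis (\<omega> * x)) * complex_of_real c"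
  proof -
    have "(\<lambda>\<omega>. G \<omega> * \<phi> 0 \<omega>) = (\<lambda>\<omega>. G \<omega> * cis (\<omega> * x) * complex_of_real c)"
      by (simp add: \<phi>_def std_normal_density_def c_def mult_ac)
    then show ?thesis by simp
  qed
  moreover have "sqrt (2 * pi) * g x = 2 * pi * g x * c"
    using real_sqrt_mult_self[of "2 * pi"] by (simp add: c_def field_simps)
  ultimately have "(LINT \<omega>|lborel. G \<omega> * cis (\<omega> * x)) * complex_of_real c
      = complex_of_real (2 * pi * g x) * complex_of_real c"
    by (metis of_real_mult)
  moreover have "c \<noteq> 0" by (simp add: c_def)
  ultimately show ?thesis by simp
qed

section \<open>Bandlimited functions on a half-line of samples\<close>

text \<open>
  Since \<open>\<Omega> * T < pi\<close>, the map \<open>z \<omega> = cis (- (T * \<omega>))\<close> sends the band \<open>{-\<Omega>..\<Omega>}\<close> into an arc that misses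
  \<open>-1\<close>. The hypothesis says that \<open>\<phi>\<close>, shifted by \<open>k0\<close> samples, annihilates the nonnegative powers
  of \<open>z\<close>. For real \<open>y\<close>, the character \<open>cis (\<omega> * y)\<close> is the function \<open>w powr (- y / T)\<close> of \<open>w = z \<omega>\<close>, and this is
  continuous on the arc because the principal logarithm is. This is a special case of Carlson's
  theorem on functions of exponential type.
\<close>

lemma vanishing_on_half_line_imp_zero:
  fixes \<phi> :: "real \<Rightarrow> complex"
  assumes \<phi>: "integrable lborel \<phi>" and supp: "AE \<omega> in lborel. \<omega> \<notin> {-\<Omega>..\<Omega>} \<longrightarrow> \<phi> \<omega> = 0"
    and "\<Omega> > 0" and "T > 0" and "T < pi / \<Omega>"
    and zero: "\<And>k :: int. k \<le> k0 \<Longrightarrow> (LINT \<omega>|lborel. \<phi> \<omega> * cis (\<omega> * (of_int k * T))) = 0"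
  shows "(LINT \<omega>|lborel. \<phi> \<omega> * cis (\<omega> * x)) = 0"
proof -
  define M where "M = restrict_space lborel {-\<Omega>..\<Omega>}"
  define z where "z \<omega> = cis (- (T * \<omega>))" for \<omega>
  have \<Omega>T: "\<Omega> * T < pi" using assms by (simp add: field_simps)
  have space_M: "space M = {-\<Omega>..\<Omega>}" by (simp add: M_def)
  have angle: "\<bar>T * \<omega>\<bar> \<le> \<Omega> * T" if "\<omega> \<in> space M" for \<omega>
    using that \<open>T > 0\<close> by (auto simp: space_M abs_mult mult.commute intro!: mult_right_mono)
  have lborel_eq: "(LINT \<omega>|M. f \<omega> * \<phi> \<omega>) = (LINT \<omega>|lborel. \<phi> \<omega> * f \<omega>)"
    if [measurable]: "f \<in> borel_measurable borel" for f :: "real \<Rightarrow> complex"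
  proof -
    have [measurable]: "\<phi> \<in> borel_measurable borel" using \<phi> by (auto dest: borel_measurable_integrable)
    have "(LINT \<omega>|M. f \<omega> * \<phi> \<omega>) = (LINT \<omega>|lborel. indicator {-\<Omega>..\<Omega>} \<omega> *\<^sub>R (f \<omega> * \<phi> \<omega>))"
      unfolding M_def by (subst integral_restrict_space) auto
    also have "\<dots> = (LINT \<omega>|lborel. \<phi> \<omega> * f \<omega>)"
      using supp by (intro integral_cong_AE) (auto simp: indicator_def elim!: eventually_mono)
    finally show ?thesis .
  qed
  interpret proper_arc_map M z "cos (\<Omega> * T)"
  proof
    show "z \<in> borel_measurable M" unfolding M_def z_def
      by (intro measurable_restrict_space1) measurable
    show "cmod (z \<omega>) = 1" for \<omega> by (simp add: z_def)
    show "cos (\<Omega> * T) \<le> Re (z \<omega>)" if "\<omega> \<in> space M" for \<omega>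
    proof -
      have "cos (\<Omega> * T) \<le> cos \<bar>T * \<omega>\<bar>"
        using angle[OF that] \<Omega>T by (intro cos_monotone_0_pi_le) auto
      then show ?thesis by (simp add: z_def)
    qed
    show "- 1 < cos (\<Omega> * T)"
      using cos_monotone_0_pi[of "\<Omega> * T" pi] \<Omega>T assms by simp
  qed
  define e where "e \<omega> = cis (\<omega> * (of_int k0 * T))" for \<omega>
  have [measurable]: "e \<in> borel_measurable borel" unfolding e_def by measurable
  have ann: "annihilates_powers (\<lambda>\<omega>. e \<omega> * \<phi> \<omega>)"
    unfolding annihilates_powers_def
  proof (intro conjI allI)
    have "integrable M \<phi>"
      unfolding M_def using \<phi> by (subst integrable_restrict_space) (auto intro: integrable_mult_indicator)
    then show "integrable M (\<lambda>\<omega>. e \<omega> * \<phi> \<omega>)"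
      by (rule integrable_bounded_times[rotated 2, where B = 1])
         (auto simp: e_def M_def intro!: measurable_restrict_space1)
    fix n :: nat
    have "\<omega> * (of_int k0 * T) + real n * (- (T * \<omega>)) = \<omega> * (of_int (k0 - int n) * T)" for \<omega>
      by (simp add: algebra_simps)
    then have "e \<omega> * z \<omega> ^ n = cis (\<omega> * (of_int (k0 - int n) * T))" for \<omega>
      by (simp only: e_def z_def Complex.DeMoivre cis_mult)
    then have "e \<omega> * \<phi> \<omega> * z \<omega> ^ n = cis (\<omega> * (of_int (k0 - int n) * T)) * \<phi> \<omega>" for \<omega>
      by (metis mult.assoc mult.commute)
    then have "(LINT \<omega>|M. e \<omega> * \<phi> \<omega> * z \<omega> ^ n)
        = (LINT \<omega>|M. cis (\<omega> * (of_int (k0 - int n) * T)) * \<phi> \<omega>)"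
      by presburger
    also have "\<dots> = 0"
      by (subst lborel_eq) (measurable, rule zero, simp)
    finally show "(LINT \<omega>|M. e \<omega> * \<phi> \<omega> * z \<omega> ^ n) = 0" .
  qed
  define y where "y = x - of_int k0 * T"
  define f where "f w = exp (- complex_of_real (y / T) * Ln w)" for w
  have "continuous_on {w. cmod w = 1 \<and> cos (\<Omega> * T) \<le> Re w} f"
    unfolding f_def
  proof (intro continuous_intros)
    show "w \<notin> \<real>\<^sub>\<le>\<^sub>0" if "w \<in> {w. cmod w = 1 \<and> cos (\<Omega> * T) \<le> Re w}" for w
    proof
      assume "w \<in> \<real>\<^sub>\<le>\<^sub>0"
      then obtain r where "w = of_real r" "r \<le> 0" by (auto elim: nonpos_Reals_cases)
      with that have "w = - 1" by simp
      with that \<kappa>_gt show False by simp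
    qed
  qed
  from annihilates_continuous[OF ann this]
  have "(LINT \<omega>|M. f (z \<omega>) * (e \<omega> * \<phi> \<omega>)) = 0" .
  moreover have "f (z \<omega>) * (e \<omega> * \<phi> \<omega>) = cis (\<omega> * x) * \<phi> \<omega>" if "\<omega> \<in> space M" for \<omega>
  proof -
    have "Ln (z \<omega>) = - (\<i> * of_real (T * \<omega>))"
      using angle[OF that] \<Omega>T unfolding z_def cis_conv_exp by (subst Ln_exp) auto
    then have "f (z \<omega>) = cis (\<omega> * y)"
      using \<open>T > 0\<close> by (simp add: f_def cis_conv_exp mult_ac)
    then show ?thesis by (simp add: e_def y_def cis_mult algebra_simps)
  qed
  ultimately have "(LINT \<omega>|M. cis (\<omega> * x) * \<phi> \<omega>) = 0"
    by (metis (no_types, lifting) Bochner_Integration.integral_cong)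
  then show ?thesis by (subst (asm) lborel_eq) auto
qed

lemma PW_representation:
  assumes g: "g \<in> PW \<Omega>" and B: "\<And>t. \<bar>g t\<bar> \<le> B"
  obtains G where "integrable lborel G" "AE \<omega> in lborel. \<omega> \<notin> {-\<Omega>..\<Omega>} \<longrightarrow> G \<omega> = 0"
    "\<And>x. (LINT \<omega>|lborel. G \<omega> * cis (\<omega> * x)) = 2 * pi * g x"
proof -
  obtain G where G: "has_L2_fourier g G" and supp: "AE \<omega> in lborel. \<omega> \<notin> {-\<Omega>..\<Omega>} \<longrightarrow> G \<omega> = 0"
    and cont: "continuous_on UNIV g"
    using g by (auto simp: PW_def)
  \<comment> \<open>Square-integrable with bounded support, hence integrable, by \<open>r \<le> 1 + r\<^sup>2\<close>.\<close>
  have "integrable lborel G"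
  proof (rule Bochner_Integration.integrable_bound)
    show "integrable lborel (\<lambda>\<omega>. indicator {-\<Omega>..\<Omega>} \<omega> + (cmod (G \<omega>))\<^sup>2)"
      using G by (intro Bochner_Integration.integrable_add integrable_real_indicator)
        (auto simp: has_L2_fourier_def emeasure_lborel_Icc_eq)
    show "G \<in> borel_measurable lborel" using G by (simp add: has_L2_fourier_def)
    have "r \<le> 1 + r\<^sup>2" for r :: real
      using zero_le_power2[of "r - 1 / 2"] by (simp add: power2_eq_square algebra_simps)
    then show "AE \<omega> in lborel. norm (G \<omega>) \<le> norm (indicator {-\<Omega>..\<Omega>} \<omega> + (cmod (G \<omega>))\<^sup>2)"
      using supp by (auto simp: indicator_def elim!: eventually_mono)
  qed
  with supp fourier_inversion[OF cont B G] show thesis using that by blast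
qed

text \<open>
  Strict oversampling makes every left half-line of samples a set of uniqueness; at the critical
  rate \<open>T = pi / \<Omega>\<close> this is false, as translates of the sinc function show.
\<close>

lemma PW_eq_of_eq_on_half_line:
  assumes "\<Omega> > 0" "T > 0" "T < pi / \<Omega>"
    and g1: "g\<^sub>1 \<in> PW \<Omega>" "\<And>t. \<bar>g\<^sub>1 t\<bar> \<le> B\<^sub>1" and g2: "g\<^sub>2 \<in> PW \<Omega>" "\<And>t. \<bar>g\<^sub>2 t\<bar> \<le> B\<^sub>2"
    and eq: "\<And>k :: int. k \<le> k0 \<Longrightarrow> g\<^sub>1 (of_int k * T) = g\<^sub>2 (of_int k * T)"
  shows "g\<^sub>1 = g\<^sub>2"
proof
  fix x
  obtain G\<^sub>1 where G1: "integrable lborel G\<^sub>1" "AE \<omega> in lborel. \<omega> \<notin> {-\<Omega>..\<Omega>} \<longrightarrow> G\<^sub>1 \<omega> = 0"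
    "\<And>x. (LINT \<omega>|lborel. G\<^sub>1 \<omega> * cis (\<omega> * x)) = 2 * pi * g\<^sub>1 x"
    using PW_representation[OF g1] by blast
  obtain G\<^sub>2 where G2: "integrable lborel G\<^sub>2" "AE \<omega> in lborel. \<omega> \<notin> {-\<Omega>..\<Omega>} \<longrightarrow> G\<^sub>2 \<omega> = 0"
    "\<And>x. (LINT \<omega>|lborel. G\<^sub>2 \<omega> * cis (\<omega> * x)) = 2 * pi * g\<^sub>2 x"
    using PW_representation[OF g2] by blast
  have int: "integrable lborel (\<lambda>\<omega>. G \<omega> * cis (\<omega> * y))" if "integrable lborel G" for G y
    by (rule Bochner_Integration.integrable_bound[OF that])
       (use that in \<open>auto simp: norm_mult dest: borel_measurable_integrable\<close>)
  have diff: "(LINT \<omega>|lborel. (G\<^sub>1 \<omega> - G\<^sub>2 \<omega>) * cis (\<omega> * y)) = 2 * pi * (g\<^sub>1 y - g\<^sub>2 y)" for y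
    using int[OF G1(1)] int[OF G2(1)] by (simp add: left_diff_distrib G1(3) G2(3) right_diff_distrib)
  have "(LINT \<omega>|lborel. (G\<^sub>1 \<omega> - G\<^sub>2 \<omega>) * cis (\<omega> * x)) = 0"
  proof (rule vanishing_on_half_line_imp_zero[OF _ _ assms(1-3)])
    show "AE \<omega> in lborel. \<omega> \<notin> {-\<Omega>..\<Omega>} \<longrightarrow> G\<^sub>1 \<omega> - G\<^sub>2 \<omega> = 0"
      using G1(2) G2(2) by eventually_elim auto
    show "(LINT \<omega>|lborel. (G\<^sub>1 \<omega> - G\<^sub>2 \<omega>) * cis (\<omega> * (of_int k * T))) = 0" if "k \<le> k0" for k
      unfolding diff using eq[OF that] by simp
  qed (use G1(1) G2(1) in auto)
  then show "g\<^sub>1 x = g\<^sub>2 x" unfolding diff by simp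
qed

section \<open>The modulo hysteresis operator before its starting point\<close>

lemma C01_bounded:
  assumes "g \<in> C01 c \<tau>\<^sub>0"
  obtains B where "\<And>t. \<bar>g t\<bar> \<le> B"
proof -
  obtain L where "L-lipschitz_on UNIV g"
    using assms by (auto simp: C01_def lipschitz_functions_def)
  then have "continuous_on {-\<bar>\<tau>\<^sub>0\<bar>..\<bar>\<tau>\<^sub>0\<bar>} g"
    using lipschitz_on_continuous_on continuous_on_subset by blast
  then have "bounded (g ` {-\<bar>\<tau>\<^sub>0\<bar>..\<bar>\<tau>\<^sub>0\<bar>})"
    by (intro compact_imp_bounded compact_continuous_image) auto
  then obtain b where b: "\<And>t. t \<in> {-\<bar>\<tau>\<^sub>0\<bar>..\<bar>\<tau>\<^sub>0\<bar>} \<Longrightarrow> \<bar>g t\<bar> \<le> b"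
    unfolding bounded_iff by fastforce
  have "\<bar>g t\<bar> \<le> max b c" for t
  proof (cases "\<bar>t\<bar> \<ge> \<bar>\<tau>\<^sub>0\<bar>")
    case True
    then have "\<bar>g t\<bar> < c" using assms by (auto simp: C01_def)
    then show ?thesis by simp
  next
    case False
    then have "t \<in> {-\<bar>\<tau>\<^sub>0\<bar>..\<bar>\<tau>\<^sub>0\<bar>}" by auto
    then show ?thesis using b[of t] by simp
  qed
  then show thesis by (rule that)
qed

text \<open>
  No folding time precedes \<open>\<tau>\<^sub>0\<close>, and a transition vanishes to the left of its folding time. A
  folding time may coincide with \<open>\<tau>\<^sub>0\<close>, and for \<open>\<alpha> = 0\<close> the transition jumps there at once; hence the
  strict inequality \<open>t < \<tau>\<^sub>0\<close> below.
\<close>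

lemma fold_time_ge_start: "ereal \<tau>\<^sub>0 \<le> fold_time lam h \<alpha> \<tau>\<^sub>0 g n"
proof (induction n)
  case (Suc n)
  then show ?case by (auto intro!: Inf_greatest simp flip: ereal_less_eq(3))
qed simp

lemma fold_signal_before_start:
  assumes "t < \<tau>\<^sub>0" "\<alpha> \<ge> 0"
  shows "fold_signal lam h \<alpha> \<tau>\<^sub>0 g n t = g t"
proof (induction n)
  case (Suc n)
  let ?\<kappa> = "fold_time lam h \<alpha> \<tau>\<^sub>0 g (Suc n)"
  have "folding_transition \<alpha> (t - real_of_ereal ?\<kappa>) = 0" if "?\<kappa> \<noteq> \<infinity>"
  proof -
    have "\<tau>\<^sub>0 \<le> real_of_ereal ?\<kappa>"
      using fold_time_ge_start[of \<tau>\<^sub>0 lam h \<alpha> g "Suc n"] that by (cases ?\<kappa>) auto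
    with assms show ?thesis by (auto simp: folding_transition_def indicator_def)
  qed
  with Suc show ?case by (simp del: fold_time.simps)
qed simp

lemma modulo_hysteresis_before_start:
  assumes "t < \<tau>\<^sub>0" "\<alpha> \<ge> 0"
  shows "modulo_hysteresis lam h \<alpha> \<tau>\<^sub>0 g t = g t"
  unfolding modulo_hysteresis_def fold_signal_before_start[OF assms] by simp

theorem corollary1:
  fixes \<Omega> lam h \<alpha> \<tau>\<^sub>0 T :: real and g\<^sub>1 g\<^sub>2 :: "real \<Rightarrow> real"
  assumes "\<Omega> > 0" and "lam > 0" and "0 \<le> h" and "h < lam" and "\<alpha> \<ge> 0"
    and "\<not> (\<alpha> = 0 \<and> h = 0)"
    and "T > 0" and "T < pi / \<Omega>"
    and "g\<^sub>1 \<in> PW \<Omega> \<inter> C11 (lam - h) \<tau>\<^sub>0"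
    and "g\<^sub>2 \<in> PW \<Omega> \<inter> C11 (lam - h) \<tau>\<^sub>0"
    and "Linf_norm (deriv (deriv g\<^sub>1)) \<le> second_deriv_bound h \<alpha>"
    and "Linf_norm (deriv (deriv g\<^sub>2)) \<le> second_deriv_bound h \<alpha>"
    and "\<And>k :: int. modulo_hysteresis lam h \<alpha> \<tau>\<^sub>0 g\<^sub>1 (of_int k * T)
                   = modulo_hysteresis lam h \<alpha> \<tau>\<^sub>0 g\<^sub>2 (of_int k * T)"
  shows "g\<^sub>1 = g\<^sub>2"
proof -
  have C01: "g\<^sub>1 \<in> C01 (lam - h) \<tau>\<^sub>0" "g\<^sub>2 \<in> C01 (lam - h) \<tau>\<^sub>0"
    using assms(9,10) by (auto simp: C11_def)
  obtain B\<^sub>1 where B1: "\<And>t. \<bar>g\<^sub>1 t\<bar> \<le> B\<^sub>1" using C01_bounded[OF C01(1)] by blast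
  obtain B\<^sub>2 where B2: "\<And>t. \<bar>g\<^sub>2 t\<bar> \<le> B\<^sub>2" using C01_bounded[OF C01(2)] by blast
  \<comment> \<open>The subtraction keeps the sample \<open>k0 * T\<close> strictly before \<open>\<tau>\<^sub>0\<close>.\<close>
  define k0 where "k0 = \<lfloor>\<tau>\<^sub>0 / T\<rfloor> - 1"
  have "of_int k * T < \<tau>\<^sub>0" if "k \<le> k0" for k
  proof -
    have "of_int k < \<tau>\<^sub>0 / T" using that unfolding k0_def by linarith
    then show ?thesis using \<open>T > 0\<close> by (simp add: pos_less_divide_eq)
  qed
  then have eq: "g\<^sub>1 (of_int k * T) = g\<^sub>2 (of_int k * T)" if "k \<le> k0" for k
    using assms(13)[of k] that \<open>\<alpha> \<ge> 0\<close> by (simp add: modulo_hysteresis_before_start)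
  show ?thesis
    by (rule PW_eq_of_eq_on_half_line[of \<Omega> T g\<^sub>1 B\<^sub>1 g\<^sub>2 B\<^sub>2 k0]) (use assms(1,7-10) B1 B2 eq in auto)
qed

end
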